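(* Let $S = c_0\cdot c_1\cdots c_{m-1}$ be a satisfiability problem with $m$ clauses in $n$ Boolean variables, and let $N\ge n$ be an integer. If the logical boosting algorithm LB(N) run on $S$ asserts that $S$ is satisfiable, then $S$ is indeed satisfiable. Moreover, the probability of error $P_{err}$ in the case that it asserts that $S$ is unsatisfiable (that is, the probability that LB(N) asserts "unsatisfiable" when $S$ is in fact satisfiable) satisfies $$P_{err} < \left(\frac{1}{e}\right)^{2^{N-n}},$$ where $e$ is the Euler number.
   Context: A literal is a Boolean variable or its negation; a clause is a disjunction of literals. The satisfiability problem: given clauses $c_0,\dots,c_{m-1}$ in Boolean variables $x_0,\dots,x_{n-1}$, decide whether the conjunction $c_0\cdots c_{m-1}$ is satisfiable. A binary random variable takes values in $\{0,1\}$; $\&$, $\|$, $\sim$ denote and, or, not applied to such variables (or to qubits, in the sense of $0/1$ measurement outcomes). $\mathbf{C}$ is an exact cloning function: for any binary random variable (or qubit) $X$, $\mathbf{C}(X)$ is independent of $X$ and identically distributed. The algorithm LB(N), with integer parameter $N\ge n$: 1. Create independent binary random variables (or qubits) $X_0,\dots,X_{n-1}$ with $P(X_i=1)=P(X_i=0)=1/2$. 2. For each clause $c_j$ with non-negated variables $x_{i_0},\dots,x_{i_a}$ and negated variables $x_{k_0},\dots,x_{k_b}$, form $C_j = X_{i_0}\|\cdots\|X_{i_a}\|(\sim X_{k_0})\|\cdots\|(\sim X_{k_b})$. 3. Form $D_0 = C_0\,\&\cdots\&\,C_{m-1}$. 4. For $v=1,\dots,N$ form $D_v = D_{v-1}\,\|\,\mathbf{C}(D_{v-1})$.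 5. Look at $D_N$: if it is $1$, assert that the problem is satisfiable; otherwise assert that it is unsatisfiable. (An outcome "asserted" by the algorithm is one that occurs with positive probability.) *)

theory Defs
  imports "HOL-Probability.Probability"
begin

datatype literal = Pos nat | Neg nat

type_synonym clause = "literal list"

primrec lit_var :: "literal \<Rightarrow> nat" where
  "lit_var (Pos i) = i"
| "lit_var (Neg i) = i"

primrec lit_true :: "(nat \<Rightarrow> bool) \<Rightarrow> literal \<Rightarrow> bool" where
  "lit_true a (Pos i) = a i"
| "lit_true a (Neg i) = (\<not> a i)"

definition clause_true :: "(nat \<Rightarrow> bool) \<Rightarrow> clause \<Rightarrow> bool" where
  "clause_true a c \<longleftrightarrow> (\<exists>l\<in>set c. lit_true a l)"

definition sat_problem :: "nat \<Rightarrow> nat \<Rightarrow> clause list \<Rightarrow> bool" where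
  "sat_problem m n S \<longleftrightarrow> length S = m \<and> (\<forall>c\<in>set S. \<forall>l\<in>set c. lit_var l < n)"

definition satisfiable :: "clause list \<Rightarrow> bool" where
  "satisfiable S \<longleftrightarrow> (\<exists>a. \<forall>c\<in>set S. clause_true a c)"

text \<open>Binary random variables on a probability space \<open>M\<close> are Boolean-valued,
  with \<^term>\<open>True\<close> standing for 1. Qubits enter only through their measurement outcomes.\<close>

abbreviation binary_rv :: "'w measure \<Rightarrow> ('w \<Rightarrow> bool) \<Rightarrow> bool" where
  "binary_rv M X \<equiv> X \<in> measurable M (count_space UNIV)"

text \<open>The cloning function is a total function on the binary random variables of \<open>M\<close>. Each clone
  is independent of the variable cloned; nothing is required of its joint distribution with
  other variables.\<close>

definition exact_cloning :: "'w measure \<Rightarrow> (('w \<Rightarrow> bool) \<Rightarrow> 'w \<Rightarrow> bool) \<Rightarrow> bool" where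
  "exact_cloning M C \<longleftrightarrow>
     (\<forall>X. binary_rv M X \<longrightarrow>
        binary_rv M (C X) \<and>
        prob_space.indep_var M (count_space UNIV) X (count_space UNIV) (C X) \<and>
        distr M (count_space UNIV) (C X) = distr M (count_space UNIV) X)"

definition fair_bits :: "'w measure \<Rightarrow> nat \<Rightarrow> (nat \<Rightarrow> 'w \<Rightarrow> bool) \<Rightarrow> bool" where
  "fair_bits M n X \<longleftrightarrow>
     prob_space.indep_vars M (\<lambda>_. count_space UNIV) X {..<n} \<and>
     (\<forall>i<n. \<P>(\<omega> in M. X i \<omega>) = 1 / 2 \<and> \<P>(\<omega> in M. \<not> X i \<omega>) = 1 / 2)"

primrec lit_rv :: "(nat \<Rightarrow> 'w \<Rightarrow> bool) \<Rightarrow> literal \<Rightarrow> 'w \<Rightarrow> bool" where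
  "lit_rv X (Pos i) = X i"
| "lit_rv X (Neg i) = (\<lambda>\<omega>. \<not> X i \<omega>)"

definition clause_rv :: "(nat \<Rightarrow> 'w \<Rightarrow> bool) \<Rightarrow> clause \<Rightarrow> 'w \<Rightarrow> bool" where
  "clause_rv X c = (\<lambda>\<omega>. \<exists>l\<in>set c. lit_rv X l \<omega>)"

text \<open>\<open>LB C X S v\<close> is the variable \<open>D\<^sub>v\<close>; a run of the algorithm with parameter \<open>N\<close> observes
  \<open>LB C X S N\<close> and asserts satisfiability iff the observed value is \<^term>\<open>True\<close>.\<close>

primrec LB :: "(('w \<Rightarrow> bool) \<Rightarrow> 'w \<Rightarrow> bool) \<Rightarrow> (nat \<Rightarrow> 'w \<Rightarrow> bool) \<Rightarrow> clause list \<Rightarrow> nat \<Rightarrow> 'w \<Rightarrow> bool"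
where
  "LB C X S 0 = (\<lambda>\<omega>. \<forall>c\<in>set S. clause_rv X c \<omega>)"
| "LB C X S (Suc v) = (\<lambda>\<omega>. LB C X S v \<omega> \<or> C (LB C X S v) \<omega>)"

lemma (in prob_space) exact_cloning_if_split:
  assumes split: "\<And>A t. A \<in> events \<Longrightarrow> 0 \<le> t \<Longrightarrow> t \<le> 1 \<Longrightarrow>
    \<exists>B\<in>events. B \<subseteq> A \<and> prob B = t * prob A"
  shows "\<exists>C. exact_cloning M C"
proof -
  have "\<exists>Y. binary_rv M Y \<and> indep_var (count_space UNIV) X (count_space UNIV) Y \<and>
      distr M (count_space UNIV) Y = distr M (count_space UNIV) X"
    if X [measurable]: "binary_rv M X" for X
  proof -
    define A where "A = {\<omega> \<in> space M. X \<omega>}"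
    define A' where "A' = {\<omega> \<in> space M. \<not> X \<omega>}"
    define t where "t = prob A"
    have A [measurable]: "A \<in> events" "A' \<in> events" by (auto simp: A_def A'_def)
    have t: "0 \<le> t" "t \<le> 1" by (auto simp: t_def)
    obtain B1 where B1 [measurable]: "B1 \<in> events" and B1': "B1 \<subseteq> A" "prob B1 = t * prob A"
      using split[OF A(1) t] by auto
    obtain B2 where B2 [measurable]: "B2 \<in> events" and B2': "B2 \<subseteq> A'" "prob B2 = t * prob A'"
      using split[OF A(2) t] by auto
    have sub: "B1 \<subseteq> space M" "B2 \<subseteq> space M" using B1' B2' by (auto simp: A_def A'_def)
    have disj: "A \<inter> A' = {}" by (auto simp: A_def A'_def)
    have comp: "A' = space M - A" by (auto simp: A_def A'_def)
    have pA': "prob A' = 1 - t" unfolding comp t_def by (simp add: prob_compl)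
    define Y where "Y = (\<lambda>\<omega>. \<omega> \<in> B1 \<union> B2)"
    have Y [measurable]: "binary_rv M Y" unfolding Y_def by measurable
    have pB: "prob (B1 \<union> B2) = t"
    proof -
      have "prob (B1 \<union> B2) = prob B1 + prob B2"
        using B1' B2' disj by (intro finite_measure_Union) auto
      thus ?thesis using B1' B2' pA' by (simp add: t_def algebra_simps)
    qed
    have XY: "{\<omega> \<in> space M. X \<omega> \<and> Y \<omega>} = B1" "{\<omega> \<in> space M. \<not> X \<omega> \<and> Y \<omega>} = B2"
       "{\<omega> \<in> space M. X \<omega> \<and> \<not> Y \<omega>} = A - B1" "{\<omega> \<in> space M. \<not> X \<omega> \<and> \<not> Y \<omega>} = A' - B2"
      using B1' B2' sub by (auto simp: Y_def A_def A'_def)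
    have m1: "prob {\<omega> \<in> space M. X \<omega>} = t" by (simp add: t_def A_def)
    have m2: "prob {\<omega> \<in> space M. \<not> X \<omega>} = 1 - t" using pA' by (simp add: A'_def)
    have "{\<omega> \<in> space M. Y \<omega>} = B1 \<union> B2" using sub by (auto simp: Y_def)
    hence m3: "prob {\<omega> \<in> space M. Y \<omega>} = t" using pB by simp
    have "{\<omega> \<in> space M. \<not> Y \<omega>} = space M - (B1 \<union> B2)" using sub by (auto simp: Y_def)
    hence m4: "prob {\<omega> \<in> space M. \<not> Y \<omega>} = 1 - t" using pB prob_compl[of "B1 \<union> B2"] by simp
    have m5: "prob {\<omega> \<in> space M. X \<omega> \<and> Y \<omega>} = t * t" "prob {\<omega> \<in> space M. \<not> X \<omega> \<and> Y \<omega>} = t * (1 - t)"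
      unfolding XY using B1' B2' pA' by (simp_all add: t_def)
    have m6: "prob {\<omega> \<in> space M. X \<omega> \<and> \<not> Y \<omega>} = t * (1 - t)"
       "prob {\<omega> \<in> space M. \<not> X \<omega> \<and> \<not> Y \<omega>} = (1 - t) * (1 - t)"
      unfolding XY using B1' B2' pA' by (simp_all add: finite_measure_Diff t_def algebra_simps)
    have joint: "prob {\<omega> \<in> space M. X \<omega> = a \<and> Y \<omega> = b} =
        prob {\<omega> \<in> space M. X \<omega> = a} * prob {\<omega> \<in> space M. Y \<omega> = b}" for a b
      using m1 m2 m3 m4 m5 m6 by (cases a; cases b) auto
    have eqd: "prob {\<omega> \<in> space M. X \<omega> = a} = prob {\<omega> \<in> space M. Y \<omega> = a}" for a
      using m1 m2 m3 m4 by (cases a) auto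
    have "distr M (count_space UNIV) Y = distr M (count_space UNIV) X"
    proof (rule measure_eqI_finite)
      show "sets (distr M (count_space UNIV) Y) = Pow UNIV"
           "sets (distr M (count_space UNIV) X) = Pow UNIV" by auto
      fix a
      show "emeasure (distr M (count_space UNIV) Y) {a} = emeasure (distr M (count_space UNIV) X) {a}"
        using eqd[of a] by (simp add: emeasure_distr vimage_def Int_def emeasure_eq_measure conj_commute)
    qed auto
    moreover have "indep_var (count_space UNIV) X (count_space UNIV) Y"
      unfolding indep_var_distribution_eq
    proof (intro conjI)
      interpret DX: prob_space "distr M (count_space UNIV) X" by (rule prob_space_distr) simp
      interpret DY: prob_space "distr M (count_space UNIV) Y" by (rule prob_space_distr) simp
      have ss: "sets (count_space (UNIV::bool set) \<Otimes>\<^sub>M count_space (UNIV::bool set)) = Pow UNIV"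
        by (subst pair_measure_countable) auto
      show "distr M (count_space UNIV) X \<Otimes>\<^sub>M distr M (count_space UNIV) Y =
        distr M (count_space UNIV \<Otimes>\<^sub>M count_space UNIV) (\<lambda>x. (X x, Y x))"
      proof (rule measure_eqI_finite)
        show "sets (distr M (count_space UNIV) X \<Otimes>\<^sub>M distr M (count_space UNIV) Y) = Pow UNIV"
          by (subst sets_pair_measure_cong[OF sets_distr sets_distr]) (rule ss)
        show "sets (distr M (count_space UNIV \<Otimes>\<^sub>M count_space UNIV) (\<lambda>x. (X x, Y x))) = Pow UNIV"
          using ss by simp
        fix p :: "bool \<times> bool"
        obtain a b where p: "p = (a, b)" by force
        have "emeasure (distr M (count_space UNIV) X \<Otimes>\<^sub>M distr M (count_space UNIV) Y) ({a} \<times> {b}) =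
          emeasure (distr M (count_space UNIV) X) {a} * emeasure (distr M (count_space UNIV) Y) {b}"
          by (rule DY.emeasure_pair_measure_Times) auto
        also have "\<dots> = ennreal (prob {\<omega> \<in> space M. X \<omega> = a} * prob {\<omega> \<in> space M. Y \<omega> = b})"
          by (simp add: emeasure_distr vimage_def Int_def emeasure_eq_measure conj_commute ennreal_mult)
        also have "\<dots> = emeasure (distr M (count_space UNIV \<Otimes>\<^sub>M count_space UNIV) (\<lambda>x. (X x, Y x))) {p}"
          using joint[of a b] p ss
          by (simp add: emeasure_distr vimage_def Int_def emeasure_eq_measure conj_commute)
        finally show "emeasure (distr M (count_space UNIV) X \<Otimes>\<^sub>M distr M (count_space UNIV) Y) {p} = \<dots>"
          by (simp add: p)
      qed auto
    qed auto
    ultimately show ?thesis using Y by blast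
  qed
  hence "\<exists>C. \<forall>X. binary_rv M X \<longrightarrow> binary_rv M (C X) \<and>
      indep_var (count_space UNIV) X (count_space UNIV) (C X) \<and>
      distr M (count_space UNIV) (C X) = distr M (count_space UNIV) X" by metis
  thus ?thesis unfolding exact_cloning_def .
qed

text \<open>Such a cloning function and arbitrarily many fair bits do exist together on a suitable
  (atomless) space.\<close>

lemma exact_cloning_fair_bits_exist:
  "\<exists>(M :: (nat \<Rightarrow> real) measure) C X. prob_space M \<and> exact_cloning M C \<and> (\<forall>n. fair_bits M n X)"
proof -
  define U where "U = uniform_measure lborel {0..1::real}"
  define M where "M = PiM (UNIV :: nat set) (\<lambda>_. U)"
  have U: "prob_space U" unfolding U_def by (rule prob_space_uniform_measure) auto
  interpret U: prob_space U by (rule U)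
  have sU [measurable_cong]: "sets U = sets borel" by (simp add: U_def)
  have Ule: "measure U {s<..s'} \<le> s' - s" if "s \<le> s'" for s s'
  proof -
    have "measure U {s<..s'} = measure lborel ({0..1} \<inter> {s<..s'})"
      unfolding U_def by (subst measure_uniform_measure) auto
    also have "\<dots> \<le> measure lborel {s<..s'}"
      using that by (intro measure_mono_fmeasurable) (auto simp: fmeasurable_def)
    finally show ?thesis using that by simp
  qed
  have U0: "measure U {..0} = 0" 
  proof -
    have "{0..1} \<inter> {..0::real} = {0}" by auto
    thus ?thesis unfolding U_def by (subst measure_uniform_measure) auto
  qed
  have U1: "measure U {..1} = 1" 
  proof -
    have "{0..1} \<inter> {..1::real} = {0..1}" by auto
    thus ?thesis unfolding U_def by (subst measure_uniform_measure) auto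
  qed
  have Uh: "measure U {..1/2} = 1/2" 
  proof -
    have "{0..1} \<inter> {..1/2::real} = {0..1/2}" by auto
    thus ?thesis unfolding U_def by (subst measure_uniform_measure) auto
  qed
  interpret M: prob_space M unfolding M_def by (intro prob_space_PiM U)
  have spM: "space M = UNIV" by (simp add: M_def space_PiM U_def)
  have comp [measurable]: "(\<lambda>\<omega>. \<omega> i) \<in> measurable M borel" for i
  proof -
    have "(\<lambda>\<omega>. \<omega> i) \<in> measurable M U" unfolding M_def by measurable
    thus ?thesis by (simp cong: measurable_cong_sets add: sU)
  qed
  have pc: "M.prob {\<omega>. \<omega> i \<in> A} = measure U A" if "A \<in> sets borel" for i A
  proof -
    have "distr M U (\<lambda>\<omega>. \<omega> i) = U" unfolding M_def by (rule distr_PiM_component[OF U]) simp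
    hence "measure U A = measure (distr M U (\<lambda>\<omega>. \<omega> i)) A" by simp
    also have "\<dots> = M.prob ((\<lambda>\<omega>. \<omega> i) -` A \<inter> space M)"
      using that by (intro measure_distr) (auto simp: M_def sU)
    finally show ?thesis by (simp add: spM vimage_def)
  qed
  have "\<exists>C. exact_cloning M C"
  proof (rule M.exact_cloning_if_split)
    fix A t assume A [measurable]: "A \<in> M.events" and t: "0 \<le> t" "t \<le> (1::real)"
    define g where "g s = M.prob (A \<inter> {\<omega>. \<omega> 0 \<le> s})" for s
    have ev [measurable]: "A \<inter> {\<omega>. \<omega> 0 \<le> s} \<in> M.events" for s
    proof -
      have "{\<omega> \<in> space M. \<omega> 0 \<le> s} \<in> M.events" by measurable
      thus ?thesis by (simp add: spM sets.Int[OF A])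
    qed
    have evI: "{\<omega>. \<omega> 0 \<in> {s<..s'}} \<in> M.events" for s s'
    proof -
      have "{\<omega> \<in> space M. \<omega> 0 \<in> {s<..s'}} \<in> M.events" by measurable
      thus ?thesis by (simp add: spM)
    qed
    have lip: "g s \<le> g s' \<and> g s' - g s \<le> s' - s" if "s \<le> s'" for s s'
    proof
      show "g s \<le> g s'" unfolding g_def using that by (intro M.finite_measure_mono) auto
      have "g s' \<le> M.prob ((A \<inter> {\<omega>. \<omega> 0 \<le> s}) \<union> {\<omega>. \<omega> 0 \<in> {s<..s'}})"
        unfolding g_def using evI by (intro M.finite_measure_mono sets.Un ev) auto
      also have "\<dots> \<le> g s + M.prob {\<omega>. \<omega> 0 \<in> {s<..s'}}"
        unfolding g_def using evI by (intro measure_Un_le ev) auto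
      also have "\<dots> \<le> g s + (s' - s)" using pc[of "{s<..s'}" 0] Ule[OF that] by simp
      finally show "g s' - g s \<le> s' - s" by simp
    qed
    have "1-lipschitz_on UNIV g"
    proof (rule lipschitz_onI)
      show "dist (g x) (g y) \<le> 1 * dist x y" for x y
        using lip[of x y] lip[of y x] by (cases "x \<le> y") (auto simp: dist_real_def)
    qed auto
    hence "continuous_on UNIV g" by (rule lipschitz_on_continuous_on)
    hence cont: "continuous_on {0..1} g" by (rule continuous_on_subset) auto
    have g0: "g 0 = 0"
    proof -
      have "g 0 \<le> M.prob {\<omega>. \<omega> 0 \<in> {..0}}" unfolding g_def
      proof (rule M.finite_measure_mono)
        have "{\<omega> \<in> space M. \<omega> 0 \<in> {..0}} \<in> M.events" by measurable
        thus "{\<omega>. \<omega> 0 \<in> {..0}} \<in> M.events" by (simp add: spM)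
      qed auto
      thus ?thesis using pc[of "{..0}" 0] U0 by (simp add: g_def measure_le_0_iff)
    qed
    have g1: "g 1 = M.prob A"
    proof -
      have "{\<omega> \<in> space M. \<omega> 0 \<in> {..1}} \<in> M.events" by measurable
      hence ae: "AE \<omega> in M. \<omega> 0 \<in> {..1}"
        using pc[of "{..1}" 0] U1 by (subst M.prob_Collect_eq_1[symmetric]) (auto simp: spM)
      show ?thesis unfolding g_def using ae by (intro M.finite_measure_eq_AE) (auto elim: AE_mp)
    qed
    have "\<exists>s\<ge>0. s \<le> 1 \<and> g s = t * M.prob A"
      using t g0 g1 cont by (intro IVT') (auto intro: mult_left_le_one_le)
    thus "\<exists>B\<in>M.events. B \<subseteq> A \<and> M.prob B = t * M.prob A"
      using ev unfolding g_def by blast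
  qed
  then obtain C where C: "exact_cloning M C" ..
  have "fair_bits M n (\<lambda>i \<omega>. \<omega> i \<le> 1/2)" for n
    unfolding fair_bits_def
  proof (intro conjI allI impI)
    have "M.indep_vars (\<lambda>_. U) (\<lambda>i \<omega>. \<omega> i) UNIV"
    proof (subst M.indep_vars_iff_distr_eq_PiM')
      show "distr M (PiM UNIV (\<lambda>_. U)) (\<lambda>x. \<lambda>i\<in>UNIV. x i) = PiM UNIV (\<lambda>i. distr M U (\<lambda>\<omega>. \<omega> i))"
        using distr_PiM_component[of "UNIV :: nat set" "\<lambda>_. U", OF U] by (simp add: M_def restrict_UNIV distr_id)
    qed (auto simp: M_def)
    hence "M.indep_vars (\<lambda>_. count_space UNIV) (\<lambda>i \<omega>. \<omega> i \<le> 1/2) UNIV"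
      by (rule M.indep_vars_compose2[where Y="\<lambda>i x. x \<le> 1/2"]) measurable
    thus "M.indep_vars (\<lambda>_. count_space UNIV) (\<lambda>i \<omega>. \<omega> i \<le> 1/2) {..<n}"
      by (rule M.indep_vars_subset) auto
    fix i
    show p: "\<P>(\<omega> in M. \<omega> i \<le> 1/2) = 1/2" using pc[of "{..1/2}" i] Uh by (simp add: spM)
    have "{\<omega> \<in> space M. \<omega> i \<le> 1/2} \<in> M.events" by measurable
    from M.prob_neg[OF this] p
    show "\<P>(\<omega> in M. \<not> \<omega> i \<le> 1/2) = 1/2" by simp
  qed
  thus ?thesis using C M.prob_space_axioms by blast
qed

end

theory Submission
  imports Defs
begin

text \<open>\<open>D\<^sub>v\<^sub>+\<^sub>1\<close> is 0 iff both \<open>D\<^sub>v\<close> and its clone are 0, so independence gives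
  \<open>P(D\<^sub>v\<^sub>+\<^sub>1 = 0) = P(D\<^sub>v = 0)\<^sup>2\<close> and hence \<open>P(D\<^sub>N = 0) = P(D\<^sub>0 = 0)^(2^N)\<close>.
  If \<open>S\<close> is unsatisfiable then \<open>D\<^sub>0\<close> is constantly 0, so \<open>P(D\<^sub>N = 0) = 1\<close>. If it is satisfiable, the fair bits hit a
  fixed model with probability \<open>1 / 2^n\<close>, so \<open>P(D\<^sub>0 = 0) \<le> 1 - 1 / 2^n < exp (- 1 / 2^n)\<close>.\<close>

context prob_space
begin

lemma prob_clone_eq:
  assumes "exact_cloning M C" and Y: "binary_rv M Y"
  shows "\<P>(\<omega> in M. C Y \<omega> = b) = \<P>(\<omega> in M. Y \<omega> = b)"
proof -
  have CY: "binary_rv M (C Y)"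
    and "distr M (count_space UNIV) (C Y) = distr M (count_space UNIV) Y"
    using assms unfolding exact_cloning_def by blast+
  then have "measure (distr M (count_space UNIV) (C Y)) {b} = measure (distr M (count_space UNIV) Y) {b}"
    by simp
  then show ?thesis
    using Y CY by (simp add: measure_distr vimage_def Int_def conj_commute)
qed

lemma prob_not_or_clone:
  assumes C: "exact_cloning M C" and Y: "binary_rv M Y"
  shows "\<P>(\<omega> in M. \<not> (Y \<omega> \<or> C Y \<omega>)) = \<P>(\<omega> in M. \<not> Y \<omega>)\<^sup>2"
proof -
  have "indep_var (count_space UNIV) Y (count_space UNIV) (C Y)"
    using C Y unfolding exact_cloning_def by blast
  then have "prob ((\<lambda>\<omega>. (Y \<omega>, C Y \<omega>)) -` ({False} \<times> {False}) \<inter> space M) =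
      prob (Y -` {False} \<inter> space M) * prob (C Y -` {False} \<inter> space M)"
    by (rule indep_varD) auto
  then have "\<P>(\<omega> in M. \<not> (Y \<omega> \<or> C Y \<omega>)) = \<P>(\<omega> in M. \<not> Y \<omega>) * \<P>(\<omega> in M. \<not> C Y \<omega>)"
    by (simp add: vimage_def Int_def conj_commute)
  then show ?thesis
    using prob_clone_eq[OF C Y, of False] by (simp add: power2_eq_square)
qed

text \<open>\<open>exact_cloning\<close> constrains \<open>C\<close> only on measurable variables,
  so measurability has to be carried through the recursion before each level can be cloned.\<close>

lemma binary_rv_LB:
  assumes "exact_cloning M C" and "binary_rv M (LB C X S 0)"
  shows "binary_rv M (LB C X S v)"
proof (induction v)
  case (Suc v)
  then have [measurable]: "binary_rv M (LB C X S v)" "binary_rv M (C (LB C X S v))"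
    using assms(1) unfolding exact_cloning_def by blast+
  show ?case by simp
qed (rule assms(2))

lemma prob_not_LB:
  assumes C: "exact_cloning M C" and D0: "binary_rv M (LB C X S 0)"
  shows "\<P>(\<omega> in M. \<not> LB C X S v \<omega>) = \<P>(\<omega> in M. \<not> LB C X S 0 \<omega>) ^ (2 ^ v)"
proof (induction v)
  case (Suc v)
  have "\<P>(\<omega> in M. \<not> LB C X S (Suc v) \<omega>) = \<P>(\<omega> in M. \<not> LB C X S v \<omega>)\<^sup>2"
    using prob_not_or_clone[OF C binary_rv_LB[OF C D0, of v]] by simp
  then show ?case
    \<comment> \<open>Squaring doubles the exponent: \<open>2 ^ v * 2 = 2 ^ Suc v\<close>.\<close>
    unfolding Suc.IH by (simp add: power_mult[symmetric] mult.commute)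
qed simp

text \<open>Measurability is built into \<open>indep_vars\<close>. It is known only for indices
  below \<open>n\<close>; nothing is assumed about the other \<open>X i\<close>.\<close>

lemma binary_rv_fair_bits:
  assumes "fair_bits M n X" "i < n"
  shows "binary_rv M (X i)"
  using assms unfolding fair_bits_def indep_vars_def by auto

lemma prob_fair_bits_eq:
  assumes X: "fair_bits M n X"
  shows "\<P>(\<omega> in M. \<forall>i<n. X i \<omega> = a i) = 1 / 2 ^ n"
\<comment> \<open>The product rule needs a nonempty index set, and for \<open>n = 0\<close> the
  intersection below would be \<open>UNIV\<close> instead of \<open>space M\<close>.\<close>
proof (cases "n = 0")
  case True
  then show ?thesis by (simp add: prob_space)
next
  case False
  have ind: "indep_vars (\<lambda>_. count_space UNIV) X {..<n}"
    using X by (simp add: fair_bits_def)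
  have half: "prob (X i -` {a i} \<inter> space M) = 1 / 2" if "i < n" for i
    using X that unfolding fair_bits_def
    by (cases "a i") (auto simp: vimage_def Int_def conj_commute)
  have "{\<omega> \<in> space M. \<forall>i<n. X i \<omega> = a i} = (\<Inter>i\<in>{..<n}. X i -` {a i} \<inter> space M)"
    using False by auto
  also have "prob \<dots> = (\<Prod>i\<in>{..<n}. prob (X i -` {a i} \<inter> space M))"
    using False by (intro indep_varsD[OF ind]) auto
  also have "\<dots> = (\<Prod>i<n. 1 / 2)"
    using half by (intro prod.cong) auto
  finally show ?thesis by (simp add: power_one_over)
qed

end

text \<open>Each outcome \<omega> is read as the assignment \<open>\<lambda>i. X i \<omega>\<close>,
  which turns statements about random variables into pointwise statements about truth.\<close>

lemma lit_rv_iff: "lit_rv X l \<omega> \<longleftrightarrow> lit_true (\<lambda>i. X i \<omega>) l"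
  by (cases l) auto

lemma clause_rv_iff: "clause_rv X c \<omega> \<longleftrightarrow> clause_true (\<lambda>i. X i \<omega>) c"
  by (simp add: clause_rv_def clause_true_def lit_rv_iff)

text \<open>A model assigns values to all natural numbers, while the bits are compared with it only
  below \<open>n\<close>; agreement on the variables that occur is enough.\<close>

lemma clause_true_cong:
  assumes "\<And>l. l \<in> set c \<Longrightarrow> a (lit_var l) = b (lit_var l)"
  shows "clause_true a c \<longleftrightarrow> clause_true b c"
proof -
  have "lit_true a l \<longleftrightarrow> lit_true b l" if "l \<in> set c" for l
    using assms[OF that] by (cases l) auto
  then show ?thesis by (auto simp: clause_true_def)
qed

lemma binary_rv_LB_0:
  assumes "\<And>i. i < n \<Longrightarrow> binary_rv M (X i)" and S: "sat_problem m n S"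
  shows "binary_rv M (LB C X S 0)"
proof -
  have [measurable]: "binary_rv M (lit_rv X l)" if "c \<in> set S" "l \<in> set c" for c l
  proof -
    have "lit_var l < n" using S that by (auto simp: sat_problem_def)
    then have [measurable]: "binary_rv M (X (lit_var l))" by (rule assms(1))
    show ?thesis
    proof (cases l)
      case (Pos i)
      then show ?thesis using \<open>binary_rv M (X (lit_var l))\<close> by simp
    next
      case (Neg i)
      then have "lit_rv X l = (\<lambda>\<omega>. \<not> X (lit_var l) \<omega>)" by auto
      then show ?thesis by simp
    qed
  qed
  show ?thesis
    unfolding LB.simps clause_rv_def by measurable
qed

lemma one_minus_power_less_exp:
  fixes q :: real
  assumes "0 \<le> q" "q \<le> 1 - 1 / 2 ^ n" "n \<le> N"
  shows "q ^ (2 ^ N) < (1 / exp 1) ^ (2 ^ (N - n))"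
proof -
  \<comment> \<open>The strict inequality of the final bound arises here:
    \<open>1 - x < exp (- x)\<close> whenever \<open>x\<close> is nonzero.\<close>
  have "q < exp (- (1 / 2 ^ n))"
    using assms(2) exp_minus_greater[of "1 / 2 ^ n :: real"] by simp
  then have "q ^ (2 ^ N) < exp (- (1 / 2 ^ n)) ^ (2 ^ N)"
    using assms(1) by (intro power_strict_mono) auto
  \<comment> \<open>By \<open>n \<le> N\<close> the quotient \<open>2 ^ N / 2 ^ n\<close> is
    \<open>2 ^ (N - n)\<close>, with no truncation in the subtraction.\<close>
  also have "\<dots> = exp (- (2 ^ (N - n)))"
    using assms(3) by (simp add: exp_of_nat_mult[symmetric] power_diff)
  also have "\<dots> = (1 / exp 1) ^ (2 ^ (N - n))"
    using exp_of_nat_mult[of "2 ^ (N - n)" "- 1 :: real"] by (simp add: exp_minus inverse_eq_divide)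
  finally show ?thesis .
qed

theorem theorem1:
  fixes M :: "'w measure"
    and C :: "('w \<Rightarrow> bool) \<Rightarrow> 'w \<Rightarrow> bool"
    and X :: "nat \<Rightarrow> 'w \<Rightarrow> bool"
    and S :: "clause list"
    and m n N :: nat
  assumes "prob_space M"
    and "exact_cloning M C"
    and "fair_bits M n X"
    and "sat_problem m n S"
    and "n \<le> N"
  shows "(\<P>(\<omega> in M. LB C X S N \<omega>) > 0 \<longrightarrow> satisfiable S) \<and>
         (satisfiable S \<longrightarrow> \<P>(\<omega> in M. \<not> LB C X S N \<omega>) < (1 / exp 1) ^ (2 ^ (N - n)))"
proof -
  interpret prob_space M by fact
  have D0: "binary_rv M (LB C X S 0)"
    using binary_rv_fair_bits[OF assms(3)] assms(4) by (rule binary_rv_LB_0)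
  have prob_compl_LB: "\<P>(\<omega> in M. \<not> LB C X S v \<omega>) = 1 - \<P>(\<omega> in M. LB C X S v \<omega>)" for v
  proof (rule prob_neg)
    have [measurable]: "binary_rv M (LB C X S v)"
      using assms(2) D0 by (rule binary_rv_LB)
    show "{\<omega> \<in> space M. LB C X S v \<omega>} \<in> events" by measurable
  qed
  have "satisfiable S" if "\<P>(\<omega> in M. LB C X S N \<omega>) > 0"
  proof (rule ccontr)
    assume "\<not> satisfiable S"
    then have "LB C X S 0 \<omega> = False" for \<omega>
      by (auto simp: clause_rv_iff satisfiable_def)
    then have "\<P>(\<omega> in M. \<not> LB C X S N \<omega>) = 1"
      unfolding prob_not_LB[OF assms(2) D0, of N] by (simp add: prob_space del: LB.simps)
    then show False
      using prob_compl_LB[of N] that by simp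
  qed
  moreover have "\<P>(\<omega> in M. \<not> LB C X S N \<omega>) < (1 / exp 1) ^ (2 ^ (N - n))" if sat: "satisfiable S"
  proof -
    obtain a where a: "\<forall>c\<in>set S. clause_true a c"
      using sat by (auto simp: satisfiable_def)
    have "LB C X S 0 \<omega>" if \<omega>: "\<forall>i<n. X i \<omega> = a i" for \<omega>
    proof -
      have "clause_true (\<lambda>i. X i \<omega>) c \<longleftrightarrow> clause_true a c" if "c \<in> set S" for c
        using \<omega> assms(4) that by (intro clause_true_cong) (auto simp: sat_problem_def)
      then show ?thesis using a by (simp add: clause_rv_iff)
    qed
    \<comment> \<open>One model suffices: hitting it on the first \<open>n\<close> bits is a
      subevent of \<open>D\<^sub>0 = 1\<close>, and further models can only enlarge the
      latter.\<close>
    then have "\<P>(\<omega> in M. \<forall>i<n. X i \<omega> = a i) \<le> \<P>(\<omega> in M. LB C X S 0 \<omega>)"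
      using D0 by (intro finite_measure_mono) (auto simp del: LB.simps)
    then have "\<P>(\<omega> in M. \<not> LB C X S 0 \<omega>) \<le> 1 - 1 / 2 ^ n"
      unfolding prob_fair_bits_eq[OF assms(3)] prob_compl_LB by simp
    then show ?thesis
      unfolding prob_not_LB[OF assms(2) D0, of N]
      using assms(5) by (intro one_minus_power_less_exp) auto
  qed
  ultimately show ?thesis by blast
qed

end
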